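(* Let $K$ be a multiplicative graph. Then $|\mathrm{B}(K)|$ is a multiplicative $\mathbb{Z}_2$-space.
   Context: Graphs are finite with a symmetric adjacency relation (loops allowed); a homomorphism is an adjacency-preserving vertex map, and $G\to K$ means a homomorphism exists. The tensor product $G\times H$ has vertex set $V(G)\times V(H)$, $(g,h)\sim(g',h')$ iff $g\sim g'$ and $h\sim h'$. A graph $K$ is multiplicative if for all graphs $G,H$, $G\times H\to K$ implies $G\to K$ or $H\to K$. Box complex: for $A\subseteq V(K)$ let $\mathrm{CN}(A)$ be the common neighbourhood ($\mathrm{CN}(\emptyset)=V(K)$), and $A\bowtie B$ mean every vertex of $A$ is adjacent to every vertex of $B$. After deleting isolated vertices, $\mathrm{B}(K)$ is the simplicial complex on $V(K)\times\{\circ,\bullet\}$ whose simplices are the nonempty $\sigma$ with $\sigma^\circ\bowtie\sigma^\bullet$ and $\mathrm{CN}(\sigma^\circ),\mathrm{CN}(\sigma^\bullet)\ne\emptyset$ ($\sigma^\circ=\{v:v^\circ\in\sigma\}$, $\sigma^\bullet=\{v:v^\bullet\in\sigma\}$), with involution swapping $v^\circ\leftrightarrow v^\bullet$; $|\mathrm{B}(K)|$ is its geometric realization. A $\mathbb{Z}_2$-space is a space with a continuous involution, throughout assumed (up to $\mathbb{Z}_2$-homotopy equivalence) to be the realization of a finite simplicial complex with simplicial involution; a $\mathbb{Z}_2$-map commutes with the involutions; $X\times Y$ has the product involution. A $\mathbb{Z}_2$-space $Z$ is multiplicative if for all $\mathbb{Z}_2$-spaces $X,Y$, the existence of a $\mathbb{Z}_2$-map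 $X\times Y\to Z$ implies the existence of a $\mathbb{Z}_2$-map $X\to Z$ or $Y\to Z$. *)

theory Defs
  imports "HOL-Analysis.Analysis" "Graph_Theory.Pair_Digraph"
begin

section \<open>Graphs\<close>

text \<open>
  A graph is a \<^locale>\<open>pair_pseudo_graph\<close>: finite vertex set, symmetric arc relation on it,
  loops allowed.
\<close>

definition graph_hom :: "'a pair_pre_digraph \<Rightarrow> 'b pair_pre_digraph \<Rightarrow> ('a \<Rightarrow> 'b) \<Rightarrow> bool" where
  "graph_hom G K f \<longleftrightarrow>
     f ` pverts G \<subseteq> pverts K \<and> (\<forall>u v. (u, v) \<in> parcs G \<longrightarrow> (f u, f v) \<in> parcs K)"

definition tensor_product ::
    "'a pair_pre_digraph \<Rightarrow> 'b pair_pre_digraph \<Rightarrow> ('a \<times> 'b) pair_pre_digraph" where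
  "tensor_product G H =
     \<lparr> pverts = pverts G \<times> pverts H,
       parcs = {((g, h), (g', h')) | g h g' h'. (g, g') \<in> parcs G \<and> (h, h') \<in> parcs H} \<rparr>"

text \<open>
  Every finite graph is isomorphic to one whose vertices are natural numbers, so letting
  \<open>G\<close> and \<open>H\<close> range over graphs on \<^typ>\<open>nat\<close> is no restriction.
\<close>

definition multiplicative_graph :: "'a pair_pre_digraph \<Rightarrow> bool" where
  "multiplicative_graph K \<longleftrightarrow> pair_pseudo_graph K \<and>
     (\<forall>(G :: nat pair_pre_digraph) (H :: nat pair_pre_digraph).
        pair_pseudo_graph G \<longrightarrow> pair_pseudo_graph H \<longrightarrow>
        (\<exists>f. graph_hom (tensor_product G H) K f) \<longrightarrow>
        (\<exists>f. graph_hom G K f) \<or> (\<exists>f. graph_hom H K f))"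


section \<open>Finite simplicial complexes and their realizations\<close>

text \<open>
  An abstract simplicial complex is given by its set of (nonempty) simplices; its vertex set is
  the union of all simplices. The empty complex is allowed: it is the box complex of an
  edgeless graph.
\<close>

definition finite_complex :: "'v set set \<Rightarrow> bool" where
  "finite_complex S \<longleftrightarrow> finite S \<and> (\<forall>\<sigma>\<in>S. finite \<sigma> \<and> \<sigma> \<noteq> {}) \<and>
     (\<forall>\<sigma>\<in>S. \<forall>\<tau>. \<tau> \<subseteq> \<sigma> \<and> \<tau> \<noteq> {} \<longrightarrow> \<tau> \<in> S)"

definition simplicial_involution :: "'v set set \<Rightarrow> ('v \<Rightarrow> 'v) \<Rightarrow> bool" where
  "simplicial_involution S s \<longleftrightarrow> (\<forall>\<sigma>\<in>S. s ` \<sigma> \<in> S) \<and> (\<forall>v\<in>\<Union>S. s (s v) = v)"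

text \<open>
  Points of the realization are given by barycentric coordinates. For finite complexes the
  subspace topology of the product topology is the usual topology of the realization.
\<close>

definition realization :: "'v set set \<Rightarrow> ('v \<Rightarrow> real) topology" where
  "realization S = subtopology (powertop_real UNIV)
     {x. \<exists>\<sigma>\<in>S. (\<forall>v. 0 \<le> x v) \<and> (\<forall>v. v \<notin> \<sigma> \<longrightarrow> x v = 0) \<and> (\<Sum>v\<in>\<sigma>. x v) = 1}"

text \<open>The affine extension of a vertex map: the mass at \<open>v\<close> is moved to \<open>s v\<close>.\<close>

definition realization_map :: "'v set set \<Rightarrow> ('v \<Rightarrow> 'v) \<Rightarrow> ('v \<Rightarrow> real) \<Rightarrow> ('v \<Rightarrow> real)" where
  "realization_map S s x = (\<lambda>w. \<Sum>v | v \<in> \<Union>S \<and> s v = w. x v)"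


section \<open>Spaces with involution\<close>

definition continuous_involution :: "'x topology \<Rightarrow> ('x \<Rightarrow> 'x) \<Rightarrow> bool" where
  "continuous_involution X \<nu> \<longleftrightarrow>
     continuous_map X X \<nu> \<and> (\<forall>x\<in>topspace X. \<nu> (\<nu> x) = x)"

definition equivariant :: "'x topology \<Rightarrow> ('x \<Rightarrow> 'x) \<Rightarrow> ('y \<Rightarrow> 'y) \<Rightarrow> ('x \<Rightarrow> 'y) \<Rightarrow> bool" where
  "equivariant X \<nu> \<mu> f \<longleftrightarrow> (\<forall>x\<in>topspace X. f (\<nu> x) = \<mu> (f x))"

definition z2_map ::
    "'x topology \<Rightarrow> ('x \<Rightarrow> 'x) \<Rightarrow> 'y topology \<Rightarrow> ('y \<Rightarrow> 'y) \<Rightarrow> ('x \<Rightarrow> 'y) \<Rightarrow> bool" where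
  "z2_map X \<nu> Y \<mu> f \<longleftrightarrow> continuous_map X Y f \<and> equivariant X \<nu> \<mu> f"

definition z2_homotopy_equivalent ::
    "'x topology \<Rightarrow> ('x \<Rightarrow> 'x) \<Rightarrow> 'y topology \<Rightarrow> ('y \<Rightarrow> 'y) \<Rightarrow> bool" where
  "z2_homotopy_equivalent X \<nu> Y \<mu> \<longleftrightarrow>
     (\<exists>f g. z2_map X \<nu> Y \<mu> f \<and> z2_map Y \<mu> X \<nu> g \<and>
        homotopic_with (equivariant X \<nu> \<nu>) X X (g \<circ> f) id \<and>
        homotopic_with (equivariant Y \<mu> \<mu>) Y Y (f \<circ> g) id)"

text \<open>
  The vertices of the model complex may be taken to be natural numbers, since every finite
  complex is isomorphic to such a complex.
\<close>

definition z2_space :: "'x topology \<Rightarrow> ('x \<Rightarrow> 'x) \<Rightarrow> bool" where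
  "z2_space X \<nu> \<longleftrightarrow> continuous_involution X \<nu> \<and>
     (\<exists>(S :: nat set set) s. finite_complex S \<and> simplicial_involution S s \<and>
        z2_homotopy_equivalent X \<nu> (realization S) (realization_map S s))"

text \<open>
  HOL does not allow quantification over types inside a definition, so the types carrying the
  test spaces \<open>X\<close> and \<open>Y\<close> are parameters. A theorem in which \<open>'x\<close> and \<open>'y\<close> are type variables
  speaks about all test spaces.
\<close>

definition multiplicative_z2_space ::
    "'x itself \<Rightarrow> 'y itself \<Rightarrow> 'z topology \<Rightarrow> ('z \<Rightarrow> 'z) \<Rightarrow> bool" where
  "multiplicative_z2_space _ _ Z \<zeta> \<longleftrightarrow> z2_space Z \<zeta> \<and>
     (\<forall>(X :: 'x topology) \<nu> (Y :: 'y topology) \<mu>.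
        z2_space X \<nu> \<longrightarrow> z2_space Y \<mu> \<longrightarrow>
        (\<exists>f. z2_map (prod_topology X Y) (map_prod \<nu> \<mu>) Z \<zeta> f) \<longrightarrow>
        (\<exists>f. z2_map X \<nu> Z \<zeta> f) \<or> (\<exists>f. z2_map Y \<mu> Z \<zeta> f))"


section \<open>The box complex\<close>

definition delete_isolated :: "'a pair_pre_digraph \<Rightarrow> 'a pair_pre_digraph" where
  "delete_isolated K = K \<lparr> pverts := {v \<in> pverts K. \<exists>w. (v, w) \<in> parcs K} \<rparr>"

definition common_nbhd :: "'a pair_pre_digraph \<Rightarrow> 'a set \<Rightarrow> 'a set" where
  "common_nbhd K A = {w \<in> pverts K. \<forall>v\<in>A. (v, w) \<in> parcs K}"

definition fully_adjacent :: "'a pair_pre_digraph \<Rightarrow> 'a set \<Rightarrow> 'a set \<Rightarrow> bool" where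
  "fully_adjacent K A B \<longleftrightarrow> (\<forall>a\<in>A. \<forall>b\<in>B. (a, b) \<in> parcs K)"

text \<open>
  The pair \<open>(v, False)\<close> is the white copy of the vertex \<open>v\<close> and \<open>(v, True)\<close> the black copy;
  \<open>side c \<sigma>\<close> is the set of vertices whose copy of colour \<open>c\<close> lies in \<open>\<sigma>\<close>.
\<close>

definition side :: "bool \<Rightarrow> ('a \<times> bool) set \<Rightarrow> 'a set" where
  "side c \<sigma> = {v. (v, c) \<in> \<sigma>}"

definition box_complex :: "'a pair_pre_digraph \<Rightarrow> ('a \<times> bool) set set" where
  "box_complex K = (let K' = delete_isolated K in
     {\<sigma>. \<sigma> \<noteq> {} \<and> \<sigma> \<subseteq> pverts K' \<times> UNIV \<and>
          fully_adjacent K' (side False \<sigma>) (side True \<sigma>) \<and>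
          common_nbhd K' (side False \<sigma>) \<noteq> {} \<and> common_nbhd K' (side True \<sigma>) \<noteq> {}})"

definition swap_sides :: "'a \<times> bool \<Rightarrow> 'a \<times> bool" where
  "swap_sides = (\<lambda>(v, c). (v, \<not> c))"

definition box_space :: "'a pair_pre_digraph \<Rightarrow> ('a \<times> bool \<Rightarrow> real) topology" where
  "box_space K = realization (box_complex K)"

definition box_involution ::
    "'a pair_pre_digraph \<Rightarrow> ('a \<times> bool \<Rightarrow> real) \<Rightarrow> ('a \<times> bool \<Rightarrow> real)" where
  "box_involution K = realization_map (box_complex K) swap_sides"

end

theory Submission
  imports Defs
begin

text \<open>
  A compact metric space \<open>C\<close> with involution \<open>\<nu>\<close> is discretized by its Borsuk graphs: the vertices
  form a finite dense subset, and \<open>x\<close> is adjacent to \<open>y\<close> if \<open>y\<close> is close to \<open>\<nu> x\<close>. On the one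
  hand, \<open>|B(K)|\<close> itself has a colouring by the vertices of \<open>K\<close> that gives adjacent colours to nearly
  antipodal points, so by uniform continuity a \<open>\<int>\<^sub>2\<close>-map \<open>C \<times> D \<rightarrow> |B(K)|\<close> yields a homomorphism to
  \<open>K\<close> from the product of sufficiently fine Borsuk graphs of \<open>C\<close> and \<open>D\<close>. On the other hand, a
  homomorphism to \<open>K\<close> from a sufficiently dense Borsuk graph of \<open>C\<close> extends by a partition of unity
  to a \<open>\<int>\<^sub>2\<close>-map \<open>C \<rightarrow> |B(K)|\<close>. Multiplicativity of \<open>K\<close> links the two.
\<close>

section \<open>Graphs\<close>

lemma pair_pseudo_graph_iff:
  "pair_pseudo_graph G \<longleftrightarrow>
     finite (pverts G) \<and> parcs G \<subseteq> pverts G \<times> pverts G \<and> sym (parcs G)"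
proof
  assume "pair_pseudo_graph G"
  then interpret pair_pseudo_graph G .
  show "finite (pverts G) \<and> parcs G \<subseteq> pverts G \<times> pverts G \<and> sym (parcs G)"
    using pair_finite_verts wellformed' pair_sym_arcs by (auto simp: symmetric_def)
next
  assume G: "finite (pverts G) \<and> parcs G \<subseteq> pverts G \<times> pverts G \<and> sym (parcs G)"
  then have "finite (parcs G)"
    using finite_subset by blast
  with G show "pair_pseudo_graph G"
    by unfold_locales (auto simp: symmetric_def)
qed

section \<open>Transport of graphs along vertex relabellings\<close>

definition relabel_graph :: "('b \<Rightarrow> 'c) \<Rightarrow> 'b pair_pre_digraph \<Rightarrow> 'c pair_pre_digraph" where
  "relabel_graph e G = \<lparr> pverts = e ` pverts G, parcs = map_prod e e ` parcs G \<rparr>"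

lemma pair_pseudo_graph_relabel:
  "pair_pseudo_graph G \<Longrightarrow> pair_pseudo_graph (relabel_graph e G)"
  unfolding pair_pseudo_graph_iff relabel_graph_def
  by (auto simp: sym_def)

lemma graph_hom_relabelD:
  "graph_hom (relabel_graph e G) K f \<Longrightarrow> graph_hom G K (f \<circ> e)"
  unfolding graph_hom_def relabel_graph_def by (force simp: image_subset_iff)

lemma graph_hom_tensor_relabel:
  assumes G: "pair_pseudo_graph G" and H: "pair_pseudo_graph H"
    and e: "inj_on e (pverts G)" and d: "inj_on d (pverts H)"
    and f: "graph_hom (tensor_product G H) K f"
  shows "graph_hom (tensor_product (relabel_graph e G) (relabel_graph d H)) K
           (f \<circ> map_prod (inv_into (pverts G) e) (inv_into (pverts H) d))"
proof -
  \<comment> \<open>Arc ends are vertices, so they lie where \<open>inv_into\<close> undoes the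
    relabelling.\<close>
  have "g \<in> pverts G" "g' \<in> pverts G" if "(g, g') \<in> parcs G" for g g'
    using G that by (auto simp: pair_pseudo_graph_iff)
  moreover have "h \<in> pverts H" "h' \<in> pverts H" if "(h, h') \<in> parcs H" for h h'
    using H that by (auto simp: pair_pseudo_graph_iff)
  ultimately show ?thesis
    using e d f unfolding graph_hom_def relabel_graph_def tensor_product_def
    by (auto simp: image_subset_iff)
qed

text \<open>A finite vertex set injects into the naturals, so the test graphs may live on any type.
  This is what admits Borsuk graphs, whose vertices are points of a metric space.\<close>

lemma multiplicative_graphD:
  fixes G :: "'b pair_pre_digraph" and H :: "'c pair_pre_digraph"
  assumes K: "multiplicative_graph K"
    and G: "pair_pseudo_graph G" and H: "pair_pseudo_graph H"
    and f: "graph_hom (tensor_product G H) K f"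
  shows "(\<exists>g. graph_hom G K g) \<or> (\<exists>h. graph_hom H K h)"
proof -
  obtain e :: "'b \<Rightarrow> nat" where e: "inj_on e (pverts G)"
    using G finite_imp_inj_to_nat_seg[of "pverts G"] by (auto simp: pair_pseudo_graph_iff)
  obtain d :: "'c \<Rightarrow> nat" where d: "inj_on d (pverts H)"
    using H finite_imp_inj_to_nat_seg[of "pverts H"] by (auto simp: pair_pseudo_graph_iff)
  have "(\<exists>g. graph_hom (relabel_graph e G) K g) \<or> (\<exists>h. graph_hom (relabel_graph d H) K h)"
    using K pair_pseudo_graph_relabel[OF G, of e] pair_pseudo_graph_relabel[OF H, of d]
      graph_hom_tensor_relabel[OF G H e d f]
    unfolding multiplicative_graph_def by blast
  then show ?thesis
    by (meson graph_hom_relabelD)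
qed


section \<open>Realizations of finite complexes\<close>

lemma finite_complexD:
  assumes "finite_complex S"
  shows "finite S" "finite (\<Union>S)" "\<sigma> \<in> S \<Longrightarrow> finite \<sigma>" "\<sigma> \<in> S \<Longrightarrow> \<sigma> \<noteq> {}"
    "\<sigma> \<in> S \<Longrightarrow> \<tau> \<subseteq> \<sigma> \<Longrightarrow> \<tau> \<noteq> {} \<Longrightarrow> \<tau> \<in> S"
  using assms unfolding finite_complex_def by blast+

lemma topspace_realization:
  "topspace (realization S) =
     {x. \<exists>\<sigma>\<in>S. (\<forall>v. 0 \<le> x v) \<and> (\<forall>v. v \<notin> \<sigma> \<longrightarrow> x v = 0) \<and> (\<Sum>v\<in>\<sigma>. x v) = 1}"
  by (simp add: realization_def)

text \<open>The support of a point is nonempty because its mass is 1, and it is a face of any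
  simplex carrying the point. It thus serves as a canonical carrier, and the mass can be summed over
  one fixed finite vertex set.\<close>

lemma in_topspace_realization_iff:
  assumes "finite_complex S"
  shows "x \<in> topspace (realization S) \<longleftrightarrow>
    {v. x v \<noteq> 0} \<in> S \<and> (\<forall>v. 0 \<le> x v) \<and> (\<Sum>v\<in>\<Union>S. x v) = 1" (is "_ \<longleftrightarrow> ?R")
proof
  assume "x \<in> topspace (realization S)"
  then obtain \<sigma> where \<sigma>: "\<sigma> \<in> S" "\<forall>v. 0 \<le> x v" "\<forall>v. v \<notin> \<sigma> \<longrightarrow> x v = 0" "(\<Sum>v\<in>\<sigma>. x v) = 1"
    by (auto simp: topspace_realization)
  have "{v. x v \<noteq> 0} \<noteq> {}"
  proof
    assume "{v. x v \<noteq> 0} = {}"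
    then have "(\<Sum>v\<in>\<sigma>. x v) = 0"
      by (intro sum.neutral) auto
    with \<sigma>(4) show False
      by simp
  qed
  moreover have "{v. x v \<noteq> 0} \<subseteq> \<sigma>"
    using \<sigma> by auto
  ultimately have "{v. x v \<noteq> 0} \<in> S"
    using finite_complexD(5)[OF assms \<sigma>(1)] by simp
  moreover have "(\<Sum>v\<in>\<Union>S. x v) = (\<Sum>v\<in>\<sigma>. x v)"
    using finite_complexD(2)[OF assms] \<sigma> by (intro sum.mono_neutral_right) auto
  ultimately show ?R
    using \<sigma> by simp
next
  assume R: ?R
  have "(\<Sum>v | x v \<noteq> 0. x v) = (\<Sum>v\<in>\<Union>S. x v)"
    using finite_complexD(2)[OF assms] R by (intro sum.mono_neutral_left) auto
  with R show "x \<in> topspace (realization S)"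
    by (auto simp: topspace_realization intro!: bexI[of _ "{v. x v \<noteq> 0}"])
qed

lemma realization_zero_outside:
  "x \<in> topspace (realization S) \<Longrightarrow> v \<notin> \<Union>S \<Longrightarrow> x v = 0"
  by (auto simp: topspace_realization)

lemma continuous_map_into_realization:
  "continuous_map X (realization S) f \<longleftrightarrow>
     (\<forall>v. continuous_map X euclideanreal (\<lambda>x. f x v)) \<and>
     f \<in> topspace X \<rightarrow> topspace (realization S)"
  unfolding realization_def continuous_map_in_subtopology continuous_map_componentwise_UNIV
  by simp

lemma continuous_map_realization_coordinate:
  "continuous_map (realization S) euclideanreal (\<lambda>x. x v)"
  unfolding realization_def
  by (intro continuous_map_from_subtopology continuous_map_product_projection) simp

text \<open>Identifies the realization with a subspace of a function type. For vertices in
  \<open>nat\<close> that type is a metric space, so compactness there gives uniform continuity and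
  finite nets.\<close>

lemma realization_eq_top_of_set:
  "realization S = top_of_set (topspace (realization S))"
  by (simp add: realization_def euclidean_product_topology)

text \<open>Nonnegative coordinates of sum 1 lie in the unit cube, which is compact by Tychonoff.
  Each closed simplex is cut out of it by closed conditions, and there are finitely many
  simplices.\<close>

lemma compact_realization:
  assumes "finite_complex S"
  shows "compact (topspace (realization S))"
proof -
  let ?cube = "PiE UNIV (\<lambda>_. {0..1}) :: ('a \<Rightarrow> real) set"
  let ?F = "\<lambda>\<sigma>. {x :: 'a \<Rightarrow> real. (\<forall>v. 0 \<le> x v) \<and> (\<forall>v. v \<notin> \<sigma> \<longrightarrow> x v = 0) \<and> (\<Sum>v\<in>\<sigma>. x v) = 1}"
  have "compactin (powertop_real UNIV) ?cube"
    by (simp only: compactin_PiE) simp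
  then have cube: "compact ?cube"
    by (simp add: euclidean_product_topology)
  have coord: "continuous_on UNIV (\<lambda>x :: 'a \<Rightarrow> real. x v)" for v
    by (rule continuous_on_product_coordinates)
  have "closed (?F \<sigma>)" for \<sigma>
    by (intro closed_Collect_conj closed_Collect_all closed_Collect_imp open_Collect_const
        closed_Collect_le closed_Collect_eq continuous_on_sum continuous_on_const coord)
  then have compact_Int: "compact (?cube \<inter> ?F \<sigma>)" for \<sigma>
    by (intro compact_Int_closed cube)
  have subset: "?F \<sigma> \<subseteq> ?cube" if "\<sigma> \<in> S" for \<sigma>
  proof
    fix x assume x: "x \<in> ?F \<sigma>"
    have "finite \<sigma>"
      using finite_complexD(3)[OF assms that] .
    have "x v \<le> 1" for v
    proof (cases "v \<in> \<sigma>")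
      case True
      then show ?thesis
        using x member_le_sum[of v \<sigma> x] \<open>finite \<sigma>\<close> by auto
    qed (use x in auto)
    then show "x \<in> ?cube"
      using x by auto
  qed
  have "compact (?F \<sigma>)" if "\<sigma> \<in> S" for \<sigma>
    using compact_Int[of \<sigma>] unfolding Int_absorb1[OF subset[OF that]] .
  moreover have "topspace (realization S) = (\<Union>\<sigma>\<in>S. ?F \<sigma>)"
    by (auto simp: topspace_realization)
  ultimately show ?thesis
    using finite_complexD(1)[OF assms] by (auto intro!: compact_UN)
qed

section \<open>Affine extensions of simplicial involutions\<close>

lemma simplicial_involution_vertex:
  assumes "simplicial_involution S s" "v \<in> \<Union>S"
  shows "s v \<in> \<Union>S" "s (s v) = v"
  using assms unfolding simplicial_involution_def by blast+

text \<open>Pushing mass forward along an involution is the same as pulling coordinates back,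
  because the fibre over a vertex \<open>w\<close> is \<open>{s w}\<close>.\<close>

lemma realization_map_involution:
  assumes "simplicial_involution S s"
  shows "realization_map S s x = (\<lambda>w. if w \<in> \<Union>S then x (s w) else 0)"
proof
  fix w
  have "v \<in> \<Union>S \<and> s v = w \<longleftrightarrow> w \<in> \<Union>S \<and> v = s w" for v
    using simplicial_involution_vertex[OF assms] by metis
  then have "{v. v \<in> \<Union>S \<and> s v = w} = (if w \<in> \<Union>S then {s w} else {})"
    by auto
  then show "realization_map S s x w = (if w \<in> \<Union>S then x (s w) else 0)"
    by (simp add: realization_map_def)
qed

lemma continuous_involution_realization:
  assumes S: "finite_complex S" and s: "simplicial_involution S s"
  shows "continuous_involution (realization S) (realization_map S s)"
  unfolding continuous_involution_def continuous_map_into_realization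
proof (intro conjI allI ballI funcsetI)
  fix v
  show "continuous_map (realization S) euclideanreal (\<lambda>x. realization_map S s x v)"
    by (cases "v \<in> \<Union>S")
      (simp_all add: realization_map_involution[OF s] continuous_map_realization_coordinate)
next
  fix x assume x: "x \<in> topspace (realization S)"
  have "{w. realization_map S s x w \<noteq> 0} = s ` {v. x v \<noteq> 0}"
    using simplicial_involution_vertex[OF s] realization_zero_outside[OF x]
    by (auto simp: realization_map_involution[OF s] image_iff) metis+
  then have "{w. realization_map S s x w \<noteq> 0} \<in> S"
    using x s by (simp add: in_topspace_realization_iff[OF S] simplicial_involution_def)
  moreover have "(\<Sum>w\<in>\<Union>S. realization_map S s x w) = (\<Sum>v\<in>\<Union>S. x v)"
    using simplicial_involution_vertex[OF s]
    by (intro sum.reindex_bij_witness[of _ s s]) (auto simp: realization_map_involution[OF s])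
  ultimately show "realization_map S s x \<in> topspace (realization S)"
    using x by (simp add: in_topspace_realization_iff[OF S] realization_map_involution[OF s])
  show "realization_map S s (realization_map S s x) = x"
    using simplicial_involution_vertex[OF s] realization_zero_outside[OF x]
    by (auto simp: realization_map_involution[OF s] fun_eq_iff)
qed

text \<open>The definition of \<open>z2_space\<close> asks for a model on natural numbers, so the
  vertices are renamed by an injection \<open>e\<close>; the induced maps of realizations are
  mutually inverse and equivariant.\<close>

lemma z2_space_realization:
  assumes S: "finite_complex S" and s: "simplicial_involution S s"
  shows "z2_space (realization S) (realization_map S s)"
proof -
  define U where "U = \<Union>S"
  have "finite U"
    using finite_complexD(2)[OF S] by (simp add: U_def)
  then obtain e :: "'a \<Rightarrow> nat" where e: "inj_on e U"
    using finite_imp_inj_to_nat_seg[of U] by auto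
  define d where "d = inv_into U e"
  have de: "d (e v) = v" if "v \<in> U" for v
    using e that by (simp add: d_def)
  define T where "T = image e ` S"
  define t where "t = e \<circ> s \<circ> d"
  have te: "t (e v) = e (s v)" if "v \<in> U" for v
    using de[OF that] by (simp add: t_def)
  have UT: "\<Union>T = e ` U"
    by (auto simp: T_def U_def)
  have sU: "s v \<in> U" "s (s v) = v" if "v \<in> U" for v
    using simplicial_involution_vertex[OF s] that by (simp_all add: U_def)
  note in_S = in_topspace_realization_iff[OF S, folded U_def]
  note zero_S = realization_zero_outside[of _ S, folded U_def]
  note map_S = realization_map_involution[OF s, folded U_def]
  have T: "finite_complex T"
    unfolding finite_complex_def
  proof (intro conjI ballI allI impI)
    show "finite T"
      using finite_complexD(1)[OF S] by (simp add: T_def)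
    fix \<sigma> assume "\<sigma> \<in> T"
    then obtain \<rho> where \<rho>: "\<rho> \<in> S" "\<sigma> = e ` \<rho>"
      by (auto simp: T_def)
    then show "finite \<sigma>" "\<sigma> \<noteq> {}"
      using finite_complexD(3,4)[OF S] by auto
    fix \<tau> assume "\<tau> \<subseteq> \<sigma> \<and> \<tau> \<noteq> {}"
    then obtain \<pi> where "\<pi> \<subseteq> \<rho>" "\<tau> = e ` \<pi>" "\<pi> \<noteq> {}"
      using \<rho> by (metis image_is_empty subset_imageE)
    then show "\<tau> \<in> T"
      using finite_complexD(5)[OF S \<rho>(1)] by (auto simp: T_def)
  qed
  have dT: "d ` \<sigma> \<in> S" if "\<sigma> \<in> T" for \<sigma>
  proof -
    obtain \<rho> where \<rho>: "\<rho> \<in> S" "\<sigma> = e ` \<rho>"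
      using \<open>\<sigma> \<in> T\<close> by (auto simp: T_def)
    have "d ` e ` \<rho> = id ` \<rho>"
      unfolding image_image using \<rho>(1) de by (intro image_cong) (auto simp: U_def)
    then have "d ` \<sigma> = \<rho>"
      using \<rho>(2) by simp
    with \<rho> show ?thesis
      by simp
  qed
  have t: "simplicial_involution T t"
    unfolding simplicial_involution_def
  proof (intro conjI ballI)
    fix \<sigma> assume "\<sigma> \<in> T"
    have "t ` \<sigma> = e ` s ` d ` \<sigma>"
      by (simp add: t_def image_comp o_assoc)
    then show "t ` \<sigma> \<in> T"
      using dT[OF \<open>\<sigma> \<in> T\<close>] s by (simp add: T_def simplicial_involution_def)
  next
    fix v assume "v \<in> \<Union>T"
    then show "t (t v) = v"
      unfolding UT using sU te by auto
  qed
  note in_T = in_topspace_realization_iff[OF T, unfolded UT]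
  note zero_T = realization_zero_outside[of _ T, unfolded UT]
  note map_T = realization_map_involution[OF t, unfolded UT]
  \<comment> \<open>Points are total functions, so the renamed coordinates are extended by 0 off the
    vertex set.\<close>
  define f :: "('a \<Rightarrow> real) \<Rightarrow> nat \<Rightarrow> real" where "f x n = (if n \<in> e ` U then x (d n) else 0)" for x n
  define g :: "(nat \<Rightarrow> real) \<Rightarrow> 'a \<Rightarrow> real" where "g y v = (if v \<in> U then y (e v) else 0)" for y v
  have f: "z2_map (realization S) (realization_map S s) (realization T) (realization_map T t) f"
    unfolding z2_map_def equivariant_def continuous_map_into_realization
  proof (intro conjI allI ballI funcsetI)
    fix n
    show "continuous_map (realization S) euclideanreal (\<lambda>x. f x n)"
      by (cases "n \<in> e ` U") (simp_all add: f_def continuous_map_realization_coordinate)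
  next
    fix x assume x: "x \<in> topspace (realization S)"
    have "{n. f x n \<noteq> 0} = e ` {v \<in> U. x v \<noteq> 0}"
      by (auto simp: f_def de inj_on_eq_iff[OF e])
    also have "{v \<in> U. x v \<noteq> 0} = {v. x v \<noteq> 0}"
      using zero_S[OF x] by auto
    finally have "{n. f x n \<noteq> 0} \<in> T"
      using x by (simp add: in_S T_def)
    moreover have "(\<Sum>n\<in>e ` U. f x n) = (\<Sum>v\<in>U. x v)"
      using de by (intro sum.reindex_bij_witness[of _ e d]) (auto simp: f_def)
    ultimately show "f x \<in> topspace (realization T)"
      using x by (simp add: in_S in_T f_def)
    show "f (realization_map S s x) = realization_map T t (f x)"
      unfolding map_S map_T using sU de te by (auto simp: fun_eq_iff f_def inj_on_eq_iff[OF e])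
  qed
  have g: "z2_map (realization T) (realization_map T t) (realization S) (realization_map S s) g"
    unfolding z2_map_def equivariant_def continuous_map_into_realization
  proof (intro conjI allI ballI funcsetI)
    fix v
    show "continuous_map (realization T) euclideanreal (\<lambda>y. g y v)"
      by (cases "v \<in> U") (simp_all add: g_def continuous_map_realization_coordinate)
  next
    fix y assume y: "y \<in> topspace (realization T)"
    have "{v. g y v \<noteq> 0} = d ` e ` {v \<in> U. y (e v) \<noteq> 0}"
      by (auto simp: g_def de image_image cong: image_cong_simp)
    also have "e ` {v \<in> U. y (e v) \<noteq> 0} = {n \<in> e ` U. y n \<noteq> 0}"
      by auto
    also have "\<dots> = {n. y n \<noteq> 0}"
      using zero_T[OF y] by blast
    finally have "{v. g y v \<noteq> 0} \<in> S"
      using y dT by (simp add: in_T)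
    moreover have "(\<Sum>v\<in>U. g y v) = (\<Sum>n\<in>e ` U. y n)"
      using de by (intro sum.reindex_bij_witness[of _ d e]) (auto simp: g_def)
    ultimately show "g y \<in> topspace (realization S)"
      using y by (simp add: in_S in_T g_def)
    show "g (realization_map T t y) = realization_map S s (g y)"
      unfolding map_S map_T using sU de te by (auto simp: fun_eq_iff g_def inj_on_eq_iff[OF e])
  qed
  have gf: "(g \<circ> f) x = id x" if "x \<in> topspace (realization S)" for x
    using de zero_S[OF that] by (auto simp: fun_eq_iff f_def g_def)
  have fg: "(f \<circ> g) y = id y" if "y \<in> topspace (realization T)" for y
    using de zero_T[OF that] by (auto simp: fun_eq_iff f_def g_def)
  have inv_S: "continuous_involution (realization S) (realization_map S s)"
    by (rule continuous_involution_realization[OF S s])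
  have inv_T: "continuous_involution (realization T) (realization_map T t)"
    by (rule continuous_involution_realization[OF T t])
  \<comment> \<open>The composites equal the identity on the space, so the homotopies can be
    constant.\<close>
  have "homotopic_with (equivariant (realization S) (realization_map S s) (realization_map S s))
          (realization S) (realization S) (g \<circ> f) id"
  proof (rule homotopic_with_equal)
    show "equivariant (realization S) (realization_map S s) (realization_map S s) (g \<circ> f)"
      using gf inv_S
      by (auto simp: equivariant_def continuous_involution_def dest: continuous_map_image_subset_topspace)
    show "equivariant (realization S) (realization_map S s) (realization_map S s) id"
      by (simp add: equivariant_def)
    show "continuous_map (realization S) (realization S) (g \<circ> f)"
      using f g by (auto simp: z2_map_def intro: continuous_map_compose)
  qed (rule gf)
  moreover have "homotopic_with (equivariant (realization T) (realization_map T t) (realization_map T t))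
          (realization T) (realization T) (f \<circ> g) id"
  proof (rule homotopic_with_equal)
    show "equivariant (realization T) (realization_map T t) (realization_map T t) (f \<circ> g)"
      using fg inv_T
      by (auto simp: equivariant_def continuous_involution_def dest: continuous_map_image_subset_topspace)
    show "equivariant (realization T) (realization_map T t) (realization_map T t) id"
      by (simp add: equivariant_def)
    show "continuous_map (realization T) (realization T) (f \<circ> g)"
      using f g by (auto simp: z2_map_def intro: continuous_map_compose)
  qed (rule fg)
  ultimately show ?thesis
    unfolding z2_space_def z2_homotopy_equivalent_def using inv_S T t f g by blast
qed

section \<open>Composition and products of equivariant maps\<close>

lemma z2_map_compose:
  assumes "z2_map X \<nu> Y \<mu> f" "z2_map Y \<mu> Z \<zeta> g"
  shows "z2_map X \<nu> Z \<zeta> (g \<circ> f)"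
  using assms unfolding z2_map_def equivariant_def
  by (auto intro: continuous_map_compose dest: continuous_map_image_subset_topspace)

lemma z2_map_map_prod:
  assumes "z2_map X \<nu> X' \<nu>' f" "z2_map Y \<mu> Y' \<mu>' g"
  shows "z2_map (prod_topology X Y) (map_prod \<nu> \<mu>) (prod_topology X' Y') (map_prod \<nu>' \<mu>') (map_prod f g)"
  using assms unfolding z2_map_def equivariant_def
  by (auto simp: map_prod_def continuous_map_prod_top)


section \<open>The box complex\<close>

text \<open>When both colours occur, every vertex of one side is a common neighbour of the other
  side, and no vertex involved is isolated. Full adjacency then implies the remaining
  conditions.\<close>

lemma box_complexI:
  assumes K: "pair_pseudo_graph K"
    and ne: "side False \<sigma> \<noteq> {}" "side True \<sigma> \<noteq> {}"
    and adj: "\<And>a b. a \<in> side False \<sigma> \<Longrightarrow> b \<in> side True \<sigma> \<Longrightarrow> (a, b) \<in> parcs K"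
  shows "\<sigma> \<in> box_complex K"
proof -
  have K': "finite (pverts K)" "parcs K \<subseteq> pverts K \<times> pverts K" "sym (parcs K)"
    using K by (auto simp: pair_pseudo_graph_iff)
  have adj': "(b, a) \<in> parcs K" if "a \<in> side False \<sigma>" "b \<in> side True \<sigma>" for a b
    using adj that K'(3) by (meson symD)
  have a: "a \<in> pverts (delete_isolated K)" if "a \<in> side False \<sigma>" for a
    using that ne adj K' by (auto simp: delete_isolated_def)
  have b: "b \<in> pverts (delete_isolated K)" if "b \<in> side True \<sigma>" for b
    using that ne adj' K' by (auto simp: delete_isolated_def)
  have "\<sigma> \<subseteq> pverts (delete_isolated K) \<times> UNIV"
  proof
    fix p assume "p \<in> \<sigma>"
    then show "p \<in> pverts (delete_isolated K) \<times> UNIV"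
      using a b by (cases p; cases "snd p") (auto simp: side_def)
  qed
  moreover have "\<sigma> \<noteq> {}"
    using ne by (auto simp: side_def)
  moreover have "side True \<sigma> \<subseteq> common_nbhd (delete_isolated K) (side False \<sigma>)"
    using b adj by (auto simp: common_nbhd_def delete_isolated_def)
  moreover have "side False \<sigma> \<subseteq> common_nbhd (delete_isolated K) (side True \<sigma>)"
    using a adj' by (auto simp: common_nbhd_def delete_isolated_def)
  ultimately show ?thesis
    using adj ne unfolding box_complex_def Let_def fully_adjacent_def delete_isolated_def
    by fastforce
qed

lemma box_complex_adjacent:
  "\<sigma> \<in> box_complex K \<Longrightarrow> (a, False) \<in> \<sigma> \<Longrightarrow> (b, True) \<in> \<sigma> \<Longrightarrow> (a, b) \<in> parcs K"
  by (auto simp: box_complex_def fully_adjacent_def side_def delete_isolated_def Let_def)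

lemma box_complex_common_neighbour:
  assumes "\<sigma> \<in> box_complex K"
  obtains w where "w \<in> pverts K" "\<And>v. (v, c) \<in> \<sigma> \<Longrightarrow> (v, w) \<in> parcs K"
  using assms
  by (cases c) (auto simp: box_complex_def common_nbhd_def side_def delete_isolated_def Let_def)

lemma Union_box_complex_subset: "\<Union>(box_complex K) \<subseteq> pverts K \<times> UNIV"
  by (auto simp: box_complex_def delete_isolated_def Let_def)

text \<open>Closure under faces holds because shrinking a set only enlarges its common
  neighbourhood.\<close>

lemma finite_complex_box_complex:
  assumes "pair_pseudo_graph K"
  shows "finite_complex (box_complex K)"
proof -
  have "finite (pverts K \<times> (UNIV :: bool set))"
    using assms by (simp add: pair_pseudo_graph_iff)
  moreover have sub: "box_complex K \<subseteq> Pow (pverts K \<times> UNIV)"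
    using Union_box_complex_subset by blast
  ultimately have "finite (box_complex K)" "\<forall>\<sigma>\<in>box_complex K. finite \<sigma>"
    by (auto intro: finite_subset)
  moreover have "\<tau> \<in> box_complex K" if "\<sigma> \<in> box_complex K" "\<tau> \<subseteq> \<sigma>" "\<tau> \<noteq> {}" for \<sigma> \<tau>
  proof -
    have "side c \<tau> \<subseteq> side c \<sigma>" for c
      using that by (auto simp: side_def)
    moreover from this have "common_nbhd G (side c \<sigma>) \<subseteq> common_nbhd G (side c \<tau>)"
      for c and G :: "'a pair_pre_digraph"
      by (fastforce simp: common_nbhd_def)
    ultimately show ?thesis
      using that unfolding box_complex_def Let_def fully_adjacent_def by blast
  qed
  moreover have "\<sigma> \<noteq> {}" if "\<sigma> \<in> box_complex K" for \<sigma>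
    using that by (auto simp: box_complex_def Let_def)
  ultimately show ?thesis
    unfolding finite_complex_def by blast
qed

lemma simplicial_involution_box_complex:
  assumes "pair_pseudo_graph K"
  shows "simplicial_involution (box_complex K) swap_sides"
proof -
  have K: "sym (parcs K)"
    using assms by (simp add: pair_pseudo_graph_iff)
  have side: "side c (swap_sides ` \<sigma>) = side (\<not> c) \<sigma>" for c and \<sigma> :: "('a \<times> bool) set"
    by (force simp: side_def swap_sides_def image_iff)
  have adj: "fully_adjacent (delete_isolated K) B A" if "fully_adjacent (delete_isolated K) A B" for A B
    using that K by (auto simp: fully_adjacent_def delete_isolated_def dest: symD)
  have "swap_sides ` \<sigma> \<subseteq> A \<times> UNIV" if "\<sigma> \<subseteq> A \<times> UNIV" for A and \<sigma> :: "('a \<times> bool) set"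
    using that by (auto simp: swap_sides_def)
  then have "swap_sides ` \<sigma> \<in> box_complex K" if "\<sigma> \<in> box_complex K" for \<sigma>
    using that adj unfolding box_complex_def Let_def mem_Collect_eq side by simp
  then show ?thesis
    by (auto simp: simplicial_involution_def swap_sides_def)
qed

lemma z2_space_box_space:
  "pair_pseudo_graph K \<Longrightarrow> z2_space (box_space K) (box_involution K)"
  unfolding box_space_def box_involution_def
  by (intro z2_space_realization finite_complex_box_complex simplicial_involution_box_complex)

text \<open>The two copies of a vertex are in the complex together or not at all. In the latter case
  both coordinates vanish, so the formula holds without a case distinction.\<close>

lemma box_involution_apply:
  assumes K: "pair_pseudo_graph K" and z: "z \<in> topspace (box_space K)"
  shows "box_involution K z (v, c) = z (v, \<not> c)"
proof -
  let ?U = "\<Union>(box_complex K)"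
  have "z (v, \<not> c) = 0" if "(v, c) \<notin> ?U"
  proof -
    have "(v, \<not> c) \<notin> ?U"
      using simplicial_involution_vertex(1)[OF simplicial_involution_box_complex[OF K], of "(v, \<not> c)"] that
      unfolding swap_sides_def prod.case not_not by blast
    then show ?thesis
      by (rule realization_zero_outside[OF z[unfolded box_space_def]])
  qed
  moreover have "box_involution K z (v, c) = (if (v, c) \<in> ?U then z (v, \<not> c) else 0)"
    unfolding box_involution_def
      realization_map_involution[OF simplicial_involution_box_complex[OF K]]
    by (simp only: swap_sides_def prod.case)
  ultimately show ?thesis
    by presburger
qed

text \<open>
  The colour of a point is its heaviest white vertex if at least a third of the mass is white, and
  a common neighbour of its black vertices otherwise. Two nearly antipodal points cannot both
  have little white mass.
\<close>

lemma box_space_colouring: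
  assumes K: "pair_pseudo_graph K"
  obtains \<eta> \<phi> where "\<eta> > 0" "\<phi> \<in> topspace (box_space K) \<rightarrow> pverts K"
    "\<And>z z'. \<lbrakk>z \<in> topspace (box_space K); z' \<in> topspace (box_space K);
       \<And>v c. v \<in> pverts K \<Longrightarrow> \<bar>z' (v, c) - z (v, \<not> c)\<bar> < \<eta>\<rbrakk> \<Longrightarrow> (\<phi> z, \<phi> z') \<in> parcs K"
proof -
  let ?V = "pverts K" and ?B = "topspace (box_space K)"
  define n where "n = card ?V"
  \<comment> \<open>Chosen so that \<open>n * \<eta> < 1 / 3\<close>: mass at least 1/3 spread over
    \<open>n\<close> vertices leaves more than \<open>\<eta>\<close> at one of them, and
    \<open>n\<close> errors below \<open>\<eta>\<close> add up to less than 1/3.\<close>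
  define \<eta> :: real where "\<eta> = 1 / (3 * (real n + 1))"
  define m where "m z = (\<Sum>v\<in>?V. z (v, False))" for z :: "'a \<times> bool \<Rightarrow> real"
  have fin: "finite ?V" and sym: "sym (parcs K)"
    using K by (auto simp: pair_pseudo_graph_iff)
  have "\<eta> > 0"
    by (simp add: \<eta>_def)
  have n\<eta>: "real n * \<eta> < 1 / 3"
    by (simp add: \<eta>_def field_simps)
  have supp: "{p. z p \<noteq> 0} \<in> box_complex K"
    and black: "(\<Sum>v\<in>?V. z (v, True)) = 1 - m z" if "z \<in> ?B" for z
  proof -
    have *: "{p. z p \<noteq> 0} \<in> box_complex K" "(\<Sum>p\<in>\<Union>(box_complex K). z p) = 1"
      using that in_topspace_realization_iff[OF finite_complex_box_complex[OF K], of z]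
      unfolding box_space_def by blast+
    then show "{p. z p \<noteq> 0} \<in> box_complex K"
      by simp
    \<comment> \<open>Coloured vertices outside the complex, such as copies of isolated ones, carry
      no mass.\<close>
    have "(\<Sum>p\<in>\<Union>(box_complex K). z p) = (\<Sum>p\<in>?V \<times> UNIV. z p)"
      using fin Union_box_complex_subset *(1) by (intro sum.mono_neutral_left) auto
    also have "\<dots> = m z + (\<Sum>v\<in>?V. z (v, True))"
      by (simp add: m_def UNIV_bool sum.distrib sum.cartesian_product' add.commute)
    finally show "(\<Sum>v\<in>?V. z (v, True)) = 1 - m z"
      using * by simp
  qed
  \<comment> \<open>Any white vertex of weight above \<open>\<eta>\<close> will do; by averaging,
    the heaviest one is such a vertex.\<close>
  have "\<exists>w\<in>?V. if m z \<ge> 1 / 3 then z (w, False) > \<eta>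
          else \<forall>v. z (v, True) \<noteq> 0 \<longrightarrow> (v, w) \<in> parcs K" if z: "z \<in> ?B" for z
  proof (cases "m z \<ge> 1 / 3")
    case True
    have "\<exists>w\<in>?V. z (w, False) > \<eta>"
    proof (rule ccontr)
      assume "\<not> ?thesis"
      then have "m z \<le> (\<Sum>v\<in>?V. \<eta>)"
        unfolding m_def by (intro sum_mono) force
      with True n\<eta> show False
        by (simp add: n_def)
    qed
    with True show ?thesis
      by simp
  next
    case False
    obtain w where "w \<in> ?V" "\<And>v. (v, True) \<in> {p. z p \<noteq> 0} \<Longrightarrow> (v, w) \<in> parcs K"
      using box_complex_common_neighbour[OF supp[OF z]] by metis
    with False show ?thesis
      by auto
  qed
  then obtain \<phi> where \<phi>V: "\<And>z. z \<in> ?B \<Longrightarrow> \<phi> z \<in> ?V"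
    and \<phi>: "\<And>z. z \<in> ?B \<Longrightarrow> if m z \<ge> 1 / 3 then z (\<phi> z, False) > \<eta>
          else \<forall>v. z (v, True) \<noteq> 0 \<longrightarrow> (v, \<phi> z) \<in> parcs K"
    by metis
  have "(\<phi> z, \<phi> z') \<in> parcs K"
    if z: "z \<in> ?B" and z': "z' \<in> ?B"
      and near: "\<And>v c. v \<in> ?V \<Longrightarrow> \<bar>z' (v, c) - z (v, \<not> c)\<bar> < \<eta>" for z z'
  proof -
    \<comment> \<open>A weight above \<open>\<eta>\<close> changes by less than
      \<open>\<eta>\<close> on passing to the opposite copy at the other point, so it stays
      positive.\<close>
    have white: "z' (\<phi> z, True) > 0" if "m z \<ge> 1 / 3"
      using \<phi>[OF z] that near[OF \<phi>V[OF z], of True] by auto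
    have white': "z (\<phi> z', True) > 0" if "m z' \<ge> 1 / 3"
      using \<phi>[OF z'] that near[OF \<phi>V[OF z'], of False] by auto
    consider "m z \<ge> 1 / 3" "m z' \<ge> 1 / 3" | "m z \<ge> 1 / 3" "\<not> m z' \<ge> 1 / 3"
      | "\<not> m z \<ge> 1 / 3" "m z' \<ge> 1 / 3" | "m z < 1 / 3" "m z' < 1 / 3"
      by linarith
    then show ?thesis
    proof cases
      \<comment> \<open>In the simplex supporting \<open>z'\<close>, the vertex
        \<open>\<phi> z'\<close> is white and \<open>\<phi> z\<close> is black.\<close>
      case 1
      then have "z' (\<phi> z', False) > 0"
        using \<phi>[OF z'] \<open>\<eta> > 0\<close> by auto
      then have "(\<phi> z', \<phi> z) \<in> parcs K"
        using box_complex_adjacent[OF supp[OF z']] white[OF 1(1)] by auto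
      then show ?thesis
        using sym by (meson symD)
    next
      case 2
      \<comment> \<open>Here \<open>\<phi> z\<close> is a black vertex of \<open>z'\<close>, and
        \<open>\<phi> z'\<close> was chosen as a common neighbour of all of these.\<close>
      then show ?thesis
        using \<phi>[OF z'] white[OF 2(1)] by auto
    next
      case 3
      then have "(\<phi> z', \<phi> z) \<in> parcs K"
        using \<phi>[OF z] white'[OF 3(2)] by auto
      then show ?thesis
        using sym by (meson symD)
    next
      case 4
      \<comment> \<open>Contradiction: the black mass of \<open>z'\<close> exceeds 2/3, yet it is at
        most \<open>n * \<eta> < 1 / 3\<close> above the white mass of \<open>z\<close>, which is
        below 1/3.\<close>
      have "1 - m z' = (\<Sum>v\<in>?V. z' (v, True))"
        using black[OF z'] by simp
      also have "\<dots> \<le> (\<Sum>v\<in>?V. z (v, False) + \<eta>)"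
        using near[of _ True] by (intro sum_mono) force
      also have "\<dots> = m z + real n * \<eta>"
        by (simp add: m_def n_def sum.distrib)
      finally show ?thesis
        using 4 n\<eta> by linarith
    qed
  qed
  moreover have "\<phi> \<in> ?B \<rightarrow> ?V"
    using \<phi>V by blast
  ultimately show ?thesis
    using that \<open>\<eta> > 0\<close> by metis
qed


section \<open>Borsuk graphs\<close>

text \<open>An involution need not be an isometry, so closeness is required in both directions to
  make adjacency symmetric.\<close>

definition borsuk_graph ::
    "'m::metric_space set \<Rightarrow> ('m \<Rightarrow> 'm) \<Rightarrow> real \<Rightarrow> 'm pair_pre_digraph" where
  "borsuk_graph V \<nu> \<delta> =
     \<lparr> pverts = V, parcs = {(x, y) \<in> V \<times> V. dist y (\<nu> x) < \<delta> \<and> dist x (\<nu> y) < \<delta>} \<rparr>"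

lemma pair_pseudo_graph_borsuk_graph:
  "finite V \<Longrightarrow> pair_pseudo_graph (borsuk_graph V \<nu> \<delta>)"
  by (auto simp: pair_pseudo_graph_iff borsuk_graph_def sym_def)

text \<open>Uniform continuity of the coordinates of \<open>f\<close> makes adjacent pairs go to
  nearly antipodal points, which receive adjacent colours. \<open>V\<close> and \<open>W\<close> are
  quantified last so that they can be chosen in terms of \<open>\<delta>\<close>.\<close>

lemma graph_hom_tensor_borsuk:
  fixes C :: "'m::metric_space set" and D :: "'n::metric_space set"
  assumes K: "pair_pseudo_graph K"
    and C: "compact C" "\<nu> \<in> C \<rightarrow> C" and D: "compact D" "\<mu> \<in> D \<rightarrow> D"
    and f: "z2_map (top_of_set (C \<times> D)) (map_prod \<nu> \<mu>) (box_space K) (box_involution K) f"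
  obtains \<delta> g where "\<delta> > 0"
    "\<And>V W. V \<subseteq> C \<Longrightarrow> W \<subseteq> D \<Longrightarrow>
       graph_hom (tensor_product (borsuk_graph V \<nu> \<delta>) (borsuk_graph W \<mu> \<delta>)) K g"
proof -
  obtain \<eta> \<phi> where \<eta>: "\<eta> > 0" and \<phi>: "\<phi> \<in> topspace (box_space K) \<rightarrow> pverts K"
    and \<phi>_edge: "\<And>z z'. \<lbrakk>z \<in> topspace (box_space K); z' \<in> topspace (box_space K);
       \<And>v c. v \<in> pverts K \<Longrightarrow> \<bar>z' (v, c) - z (v, \<not> c)\<bar> < \<eta>\<rbrakk> \<Longrightarrow> (\<phi> z, \<phi> z') \<in> parcs K"
    using box_space_colouring[OF K] by metis
  have f_cont: "continuous_on (C \<times> D) (\<lambda>q. f q p)" for p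
    using f unfolding z2_map_def box_space_def continuous_map_into_realization
      continuous_map_iff_continuous by blast
  have f_top: "f q \<in> topspace (box_space K)" if "q \<in> C \<times> D" for q
    using f that unfolding z2_map_def box_space_def continuous_map_into_realization by auto
  have f_equi: "f (\<nu> x, \<mu> y) = box_involution K (f (x, y))" if "x \<in> C" "y \<in> D" for x y
    using f that unfolding z2_map_def equivariant_def by auto
  let ?P = "pverts K \<times> (UNIV :: bool set)"
  have "\<exists>d>0. \<forall>q\<in>C \<times> D. \<forall>q'\<in>C \<times> D. dist q' q < d \<longrightarrow> \<bar>f q' p - f q p\<bar> < \<eta>" for p
    using compact_uniformly_continuous[OF f_cont[of p] compact_Times[OF C(1) D(1)]] \<eta>
    unfolding uniformly_continuous_on_def dist_real_def by blast
  then obtain d where d: "\<And>p. d p > 0"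
    "\<And>p q q'. q \<in> C \<times> D \<Longrightarrow> q' \<in> C \<times> D \<Longrightarrow> dist q' q < d p \<Longrightarrow> \<bar>f q' p - f q p\<bar> < \<eta>"
    by metis
  \<comment> \<open>The minimum is over finitely many coordinates; it is halved because a distance
    in the product is at most the sum of the two component distances. The 1 keeps the set nonempty
    when \<open>K\<close> has no vertices.\<close>
  define \<delta> where "\<delta> = Min (insert 1 (d ` ?P)) / 2"
  have finP: "finite ?P"
    using K by (simp add: pair_pseudo_graph_iff)
  then have "\<delta> > 0"
    using d(1) by (auto simp: \<delta>_def)
  have \<delta>_le: "2 * \<delta> \<le> d p" if "p \<in> ?P" for p
    using finP that by (auto simp: \<delta>_def intro!: Min_le)
  have "graph_hom (tensor_product (borsuk_graph V \<nu> \<delta>) (borsuk_graph W \<mu> \<delta>)) K (\<phi> \<circ> f)"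
    if "V \<subseteq> C" "W \<subseteq> D" for V W
  proof -
    have "(\<phi> (f (x, y)), \<phi> (f (x', y'))) \<in> parcs K"
      if x: "x \<in> C" "x' \<in> C" "dist x' (\<nu> x) < \<delta>" and y: "y \<in> D" "y' \<in> D" "dist y' (\<mu> y) < \<delta>"
      for x y x' y'
    \<comment> \<open>The point \<open>(x', y')\<close> is close to
      \<open>(\<nu> x, \<mu> y)\<close>, where by equivariance \<open>f\<close> takes the value of
      \<open>f (x, y)\<close> with colours exchanged.\<close>
    proof (rule \<phi>_edge)
      show "f (x, y) \<in> topspace (box_space K)" "f (x', y') \<in> topspace (box_space K)"
        using x y f_top by auto
      fix v c assume v: "v \<in> pverts K"
      have "dist (x', y') (\<nu> x, \<mu> y) \<le> dist x' (\<nu> x) + dist y' (\<mu> y)"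
        by (simp add: dist_Pair_Pair sqrt_sum_squares_le_sum)
      also have "\<dots> < d (v, c)"
        using x y \<delta>_le[of "(v, c)"] v by simp
      finally have "\<bar>f (x', y') (v, c) - f (\<nu> x, \<mu> y) (v, c)\<bar> < \<eta>"
        using x y C D by (intro d(2)) auto
      then show "\<bar>f (x', y') (v, c) - f (x, y) (v, \<not> c)\<bar> < \<eta>"
        using x y f_equi f_top by (simp add: box_involution_apply[OF K])
    qed
    moreover have "\<phi> (f (x, y)) \<in> pverts K" if "x \<in> C" "y \<in> D" for x y
      using \<phi> f_top that by blast
    ultimately show ?thesis
      using that unfolding graph_hom_def tensor_product_def borsuk_graph_def
      by (auto simp: subset_iff)
  qed
  with \<open>\<delta> > 0\<close> show ?thesis
    using that by blast
qed

text \<open>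
  A homomorphism from a sufficiently dense Borsuk graph extends by a partition of unity: near a
  point \<open>p\<close> one uses the white copies of the images of the vertices near \<open>p\<close> and the black copies
  of the images of those near \<open>\<nu> p\<close>. Any vertex of the first kind is adjacent to any of the second.
\<close>

lemma z2_map_of_borsuk_hom:
  fixes C :: "'m::metric_space set" and K :: "'a pair_pre_digraph"
  assumes K: "pair_pseudo_graph K"
    and C: "compact C" and \<nu>: "continuous_on C \<nu>" "\<nu> \<in> C \<rightarrow> C" "\<And>x. x \<in> C \<Longrightarrow> \<nu> (\<nu> x) = x"
    and \<delta>: "\<delta> > 0"
  obtains V where "finite V" "V \<subseteq> C"
    "\<And>h. graph_hom (borsuk_graph V \<nu> \<delta>) K h \<Longrightarrow>
       \<exists>F. z2_map (top_of_set C) \<nu> (box_space K) (box_involution K) F"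
proof -
  obtain e where e: "e > 0" "\<And>x y. x \<in> C \<Longrightarrow> y \<in> C \<Longrightarrow> dist y x < e \<Longrightarrow> dist (\<nu> y) (\<nu> x) < \<delta> / 2"
    using compact_uniformly_continuous[OF \<nu>(1) C] \<delta>
    unfolding uniformly_continuous_on_def by (meson half_gt_zero)
  \<comment> \<open>The bound \<open>e\<close> controls distances after applying
    \<open>\<nu>\<close>, and \<open>\<delta> / 2\<close> leaves room for the other leg of a
    triangle inequality.\<close>
  define r where "r = min e (\<delta> / 2)"
  have r: "r > 0" "r \<le> e" "r \<le> \<delta> / 2"
    using e \<delta> by (auto simp: r_def)
  obtain V where V: "finite V" "V \<subseteq> C" "C \<subseteq> (\<Union>x\<in>V. ball x r)"
    using seq_compact_imp_totally_bounded C r(1) by (metis compact_imp_seq_compact)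
  have "\<exists>F. z2_map (top_of_set C) \<nu> (box_space K) (box_involution K) F"
    if h: "graph_hom (borsuk_graph V \<nu> \<delta>) K h" for h
  proof -
    \<comment> \<open>Tent functions, nonzero exactly on the \<open>r\<close>-balls around the
      points of the net \<open>V\<close>. \<open>F\<close> pushes their values at \<open>p\<close>
      (white) and at \<open>\<nu> p\<close> (black) forward along \<open>h\<close>, and
      \<open>N\<close> normalizes the total mass.\<close>
    define a where "a x p = max 0 (r - dist x p)" for x p :: 'm
    define M where "M p = (\<Sum>x\<in>V. a x p)" for p
    define N where "N p = M p + M (\<nu> p)" for p
    define F :: "'m \<Rightarrow> 'a \<times> bool \<Rightarrow> real" where
      "F p = (\<lambda>(v, c). (\<Sum>x | x \<in> V \<and> h x = v. a x (if c then \<nu> p else p)) / N p)" for p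
    have a_nonneg: "a x p \<ge> 0" and a_pos: "a x p \<noteq> 0 \<longleftrightarrow> dist x p < r" for x p
      by (auto simp: a_def)
    have M_pos: "M p > 0" if p: "p \<in> C" for p
    proof -
      obtain x where "x \<in> V" "dist x p < r"
        using subsetD[OF V(3) p] by auto
      then show ?thesis
        unfolding M_def using V(1) a_nonneg a_pos by (intro sum_pos2[of _ x]) (auto simp: less_le)
    qed
    then have N_pos: "N p > 0" if "p \<in> C" for p
      using that \<nu> by (auto simp: N_def intro!: add_pos_pos)
    have F_nonzero: "F p (v, c) \<noteq> 0 \<longleftrightarrow> (\<exists>x\<in>V. h x = v \<and> dist x (if c then \<nu> p else p) < r)"
      if "p \<in> C" for p v c
      using V(1) a_nonneg a_pos N_pos[OF that]
      by (auto simp: F_def sum_nonneg_eq_0_iff)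
    have F_top: "F p \<in> topspace (box_space K)" if p: "p \<in> C" for p
    proof -
      let ?\<sigma> = "{q. F p q \<noteq> 0}"
      have \<nu>p: "\<nu> p \<in> C"
        using p \<nu> by auto
      have side: "side c ?\<sigma> = h ` {x \<in> V. dist x (if c then \<nu> p else p) < r}" for c
        using F_nonzero[OF p] by (auto simp: side_def)
      have simplex: "?\<sigma> \<in> box_complex K"
      proof (rule box_complexI[OF K])
        show "side False ?\<sigma> \<noteq> {}" "side True ?\<sigma> \<noteq> {}"
          using V(3) p \<nu>p by (force simp: side)+
        fix u v assume "u \<in> side False ?\<sigma>" "v \<in> side True ?\<sigma>"
        then obtain x y where x: "x \<in> V" "dist x p < r" "u = h x" and y: "y \<in> V" "dist y (\<nu> p) < r" "v = h y"
          by (auto simp: side)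
        \<comment> \<open>Both legs of the path from \<open>y\<close> through \<open>\<nu> p\<close>
          to \<open>\<nu> x\<close> are shorter than \<open>\<delta> / 2\<close>.\<close>
        have "dist (\<nu> x) (\<nu> p) < \<delta> / 2"
          using e(2)[OF p] x V r by auto
        then have "dist y (\<nu> x) < \<delta>"
          using y r dist_triangle2[of y "\<nu> x" "\<nu> p"] by linarith
        \<comment> \<open>The same estimate based at \<open>\<nu> p\<close>, which
          \<open>\<nu>\<close> sends back to \<open>p\<close>.\<close>
        moreover have "dist (\<nu> y) p < \<delta> / 2"
          using e(2)[OF \<nu>p, of y] y V r \<nu>(3)[OF p] by auto
        then have "dist x (\<nu> y) < \<delta>"
          using x r dist_triangle2[of x "\<nu> y" p] by linarith
        ultimately show "(u, v) \<in> parcs K"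
          using h x y by (auto simp: graph_hom_def borsuk_graph_def)
      qed
      have nonneg: "F p q \<ge> 0" for q
        using a_nonneg N_pos[OF p] by (cases q) (auto simp: F_def intro!: divide_nonneg_pos sum_nonneg)
      have total: "(\<Sum>q\<in>?\<sigma>. F p q) = 1"
      proof -
        have "?\<sigma> \<subseteq> h ` V \<times> UNIV"
          using F_nonzero[OF p] by auto
        then have "(\<Sum>q\<in>?\<sigma>. F p q) = (\<Sum>q\<in>h ` V \<times> UNIV. F p q)"
          using V(1) by (intro sum.mono_neutral_left) auto
        also have "\<dots> = (\<Sum>v\<in>h ` V. F p (v, False)) + (\<Sum>v\<in>h ` V. F p (v, True))"
          by (simp add: UNIV_bool sum.distrib sum.cartesian_product' add.commute)
        also have "(\<Sum>v\<in>h ` V. F p (v, False)) = M p / N p"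
          by (simp add: F_def M_def flip: sum_divide_distrib sum.image_gen[OF V(1)])
        also have "(\<Sum>v\<in>h ` V. F p (v, True)) = M (\<nu> p) / N p"
          by (simp add: F_def M_def flip: sum_divide_distrib sum.image_gen[OF V(1)])
        finally show ?thesis
          using N_pos[OF p] by (simp add: N_def flip: add_divide_distrib)
      qed
      show ?thesis
        unfolding box_space_def topspace_realization
      proof (intro CollectI bexI[of _ ?\<sigma>] conjI allI impI)
        show "F p q = 0" if "q \<notin> ?\<sigma>" for q
          using that by simp
      qed (fact simplex nonneg total)+
    qed
    have cont_a: "continuous_on C (\<lambda>p. a x (if c then \<nu> p else p))" for x c
      unfolding a_def using \<nu>(1) by (cases c) (auto intro!: continuous_intros)
    have cont_M: "continuous_on C M" "continuous_on C (\<lambda>p. M (\<nu> p))"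
      unfolding M_def using cont_a[of _ False] cont_a[of _ True] by (auto intro!: continuous_on_sum)
    have cont_N: "continuous_on C N"
      unfolding N_def by (intro continuous_on_add cont_M)
    have "continuous_on C (\<lambda>p. F p (v, c))" for v c
      unfolding F_def prod.case using N_pos
      by (intro continuous_on_divide continuous_on_sum cont_a cont_N) force
    then have "continuous_map (top_of_set C) (box_space K) F"
      unfolding box_space_def continuous_map_into_realization
      using F_top by (auto simp: box_space_def)
    moreover have "F (\<nu> p) = box_involution K (F p)" if p: "p \<in> C" for p
    proof
      fix q :: "'a \<times> bool"
      obtain v c where q: "q = (v, c)"
        by (cases q)
      \<comment> \<open>Replacing \<open>p\<close> by \<open>\<nu> p\<close> exchanges the two
        summands of \<open>N\<close>, just as it exchanges the colours in \<open>F\<close>.\<close>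
      have "N (\<nu> p) = N p"
        using \<nu>(3)[OF p] by (simp add: N_def)
      then show "F (\<nu> p) q = box_involution K (F p) q"
        unfolding q box_involution_apply[OF K F_top[OF p]] using \<nu>(3)[OF p] by (simp add: F_def)
    qed
    ultimately have "z2_map (top_of_set C) \<nu> (box_space K) (box_involution K) F"
      by (simp add: z2_map_def equivariant_def)
    then show ?thesis
      by blast
  qed
  with V show ?thesis
    using that by blast
qed

section \<open>Multiplicativity for compact metric spaces and for general test spaces\<close>

lemma box_space_multiplicative_compact:
  fixes C :: "'m::metric_space set" and D :: "'n::metric_space set"
  assumes K: "multiplicative_graph K"
    and C: "compact C" "continuous_involution (top_of_set C) \<nu>"
    and D: "compact D" "continuous_involution (top_of_set D) \<mu>"
    and f: "z2_map (top_of_set (C \<times> D)) (map_prod \<nu> \<mu>) (box_space K) (box_involution K) f"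
  shows "(\<exists>g. z2_map (top_of_set C) \<nu> (box_space K) (box_involution K) g) \<or>
         (\<exists>g. z2_map (top_of_set D) \<mu> (box_space K) (box_involution K) g)"
proof -
  have pseudo: "pair_pseudo_graph K"
    using K by (simp add: multiplicative_graph_def)
  have \<nu>: "continuous_on C \<nu>" "\<nu> \<in> C \<rightarrow> C" "\<And>x. x \<in> C \<Longrightarrow> \<nu> (\<nu> x) = x"
    using C(2) by (auto simp: continuous_involution_def continuous_map_in_subtopology)
  have \<mu>: "continuous_on D \<mu>" "\<mu> \<in> D \<rightarrow> D" "\<And>x. x \<in> D \<Longrightarrow> \<mu> (\<mu> x) = x"
    using D(2) by (auto simp: continuous_involution_def continuous_map_in_subtopology)
  \<comment> \<open>The scale \<open>\<delta>\<close> is dictated by the map on the product; only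
    then are nets \<open>V\<close> and \<open>W\<close> chosen, dense enough for this scale.\<close>
  obtain \<delta> g where \<delta>: "\<delta> > 0" and g: "\<And>V W. V \<subseteq> C \<Longrightarrow> W \<subseteq> D \<Longrightarrow>
       graph_hom (tensor_product (borsuk_graph V \<nu> \<delta>) (borsuk_graph W \<mu> \<delta>)) K g"
    using graph_hom_tensor_borsuk[OF pseudo C(1) \<nu>(2) D(1) \<mu>(2) f] by metis
  obtain V where V: "finite V" "V \<subseteq> C"
    "\<And>h. graph_hom (borsuk_graph V \<nu> \<delta>) K h \<Longrightarrow>
       \<exists>F. z2_map (top_of_set C) \<nu> (box_space K) (box_involution K) F"
    using z2_map_of_borsuk_hom[OF pseudo C(1) \<nu> \<delta>] by blast
  obtain W where W: "finite W" "W \<subseteq> D"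
    "\<And>h. graph_hom (borsuk_graph W \<mu> \<delta>) K h \<Longrightarrow>
       \<exists>F. z2_map (top_of_set D) \<mu> (box_space K) (box_involution K) F"
    using z2_map_of_borsuk_hom[OF pseudo D(1) \<mu> \<delta>] by blast
  show ?thesis
    using multiplicative_graphD[OF K pair_pseudo_graph_borsuk_graph[OF V(1)]
        pair_pseudo_graph_borsuk_graph[OF W(1)] g[OF V(2) W(2)]] V(3) W(3)
    by blast
qed

text \<open>Existence of an equivariant map out of \<open>X\<close> depends only on equivariant maps
  back and forth, so \<open>X\<close> may be replaced by its simplicial model, which is compact and
  metric whatever the type of \<open>X\<close>.\<close>

lemma z2_space_compact_model:
  assumes "z2_space X \<nu>"
  obtains C :: "(nat \<Rightarrow> real) set" and \<mu> f g where
    "compact C" "continuous_involution (top_of_set C) \<mu>"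
    "z2_map X \<nu> (top_of_set C) \<mu> f" "z2_map (top_of_set C) \<mu> X \<nu> g"
proof -
  obtain S :: "nat set set" and s f g where S: "finite_complex S" "simplicial_involution S s"
    and fg: "z2_map X \<nu> (realization S) (realization_map S s) f"
      "z2_map (realization S) (realization_map S s) X \<nu> g"
    using assms unfolding z2_space_def z2_homotopy_equivalent_def by blast
  show ?thesis
    using that[of "topspace (realization S)" "realization_map S s" f g] compact_realization[OF S(1)]
      continuous_involution_realization[OF S] fg
    by (simp flip: realization_eq_top_of_set)
qed

theorem theorem1p5:
  fixes K :: "'a pair_pre_digraph"
  assumes "multiplicative_graph K"
  shows "multiplicative_z2_space TYPE('x) TYPE('y) (box_space K) (box_involution K)"
  unfolding multiplicative_z2_space_def
proof (intro conjI allI impI)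
  show "z2_space (box_space K) (box_involution K)"
    using assms by (intro z2_space_box_space) (simp add: multiplicative_graph_def)
next
  fix X :: "'x topology" and \<nu> and Y :: "'y topology" and \<mu>
  assume X: "z2_space X \<nu>" and Y: "z2_space Y \<mu>"
    and "\<exists>f. z2_map (prod_topology X Y) (map_prod \<nu> \<mu>) (box_space K) (box_involution K) f"
  then obtain f where f: "z2_map (prod_topology X Y) (map_prod \<nu> \<mu>) (box_space K) (box_involution K) f"
    by blast
  obtain C :: "(nat \<Rightarrow> real) set" and \<nu>' p p' where
    C: "compact C" "continuous_involution (top_of_set C) \<nu>'"
    and p: "z2_map X \<nu> (top_of_set C) \<nu>' p" "z2_map (top_of_set C) \<nu>' X \<nu> p'"
    by (rule z2_space_compact_model[OF X])
  obtain D :: "(nat \<Rightarrow> real) set" and \<mu>' q q' where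
    D: "compact D" "continuous_involution (top_of_set D) \<mu>'"
    and q: "z2_map Y \<mu> (top_of_set D) \<mu>' q" "z2_map (top_of_set D) \<mu>' Y \<mu> q'"
    by (rule z2_space_compact_model[OF Y])
  \<comment> \<open>The maps from the models carry \<open>f\<close> to the product of the models;
    the maps into the models later bring the resulting map back to \<open>X\<close> or
    \<open>Y\<close>.\<close>
  have "z2_map (top_of_set (C \<times> D)) (map_prod \<nu>' \<mu>') (box_space K) (box_involution K)
          (f \<circ> map_prod p' q')"
    using z2_map_compose[OF z2_map_map_prod[OF p(2) q(2)] f] by simp
  then have "(\<exists>g. z2_map (top_of_set C) \<nu>' (box_space K) (box_involution K) g) \<or>
             (\<exists>g. z2_map (top_of_set D) \<mu>' (box_space K) (box_involution K) g)"
    by (rule box_space_multiplicative_compact[OF assms C D])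
  then show "(\<exists>f. z2_map X \<nu> (box_space K) (box_involution K) f) \<or>
             (\<exists>f. z2_map Y \<mu> (box_space K) (box_involution K) f)"
    using z2_map_compose[OF p(1)] z2_map_compose[OF q(1)] by blast
qed

end
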